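(* Let $T$ be a norm-unimodal bounded linear operator on a complex Hilbert space, and let $\sigma(T)$ denote its spectrum. Then there exists a sequence $\{\lambda_n\}_{n=1}^{\infty}\subset \sigma(T)\cap\{z\in\mathbb{C}: |z|>1\}$ that converges to a point $\lambda$ with $|\lambda|=1$.
   Context: A bounded linear operator $T$ on a Banach space $X$ (in particular, on a Hilbert space) is called norm-unimodal if there is a constant $r>1$ such that for every $m\in\mathbb{N}$ there exists a nonzero vector $x_m\in X$ satisfying $\lim_{k\to\infty}\|T^k x_m\|=0$ and $\|T^i x_m\|\ge r^i\|x_m\|$ for $i=1,2,\ldots,m$. *)

theory Defs
  imports "HOL-Analysis.Analysis"
begin

class scaleC = scaleR +
  fixes scaleC :: "complex \<Rightarrow> 'a \<Rightarrow> 'a" (infixr "*\<^sub>C" 75)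
  assumes scaleR_scaleC: "r *\<^sub>R x = complex_of_real r *\<^sub>C x"

class complex_vector = scaleC + ab_group_add +
  assumes scaleC_add_right: "a *\<^sub>C (x + y) = a *\<^sub>C x + a *\<^sub>C y"
    and scaleC_add_left: "(a + b) *\<^sub>C x = a *\<^sub>C x + b *\<^sub>C x"
    and scaleC_scaleC: "a *\<^sub>C b *\<^sub>C x = (a * b) *\<^sub>C x"
    and scaleC_one: "1 *\<^sub>C x = x"

subclass (in complex_vector) real_vector
  by standard
    (simp_all add: scaleR_scaleC scaleC_add_right scaleC_add_left scaleC_scaleC scaleC_one)

class complex_normed_vector = complex_vector + real_normed_vector +
  assumes norm_scaleC: "norm (a *\<^sub>C x) = cmod a * norm x"

(* The inner product is linear in its first argument and conjugate-linear in the second. *)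
class complex_inner = complex_normed_vector +
  fixes cinner :: "'a \<Rightarrow> 'a \<Rightarrow> complex"
  assumes cinner_commute: "cinner x y = cnj (cinner y x)"
    and cinner_add_left: "cinner (x + y) z = cinner x z + cinner y z"
    and cinner_scaleC_left: "cinner (a *\<^sub>C x) y = a * cinner x y"
    and cinner_ge_zero: "0 \<le> Re (cinner x x)"
    and cinner_eq_zero_iff: "cinner x x = 0 \<longleftrightarrow> x = 0"
    and norm_eq_sqrt_cinner: "norm x = sqrt (Re (cinner x x))"

class chilbert_space = complex_inner + complete_space

subclass (in chilbert_space) banach ..

definition bounded_clinear ::
    "('a::complex_normed_vector \<Rightarrow> 'b::complex_normed_vector) \<Rightarrow> bool" where
  "bounded_clinear T \<longleftrightarrow> bounded_linear T \<and> (\<forall>a x. T (a *\<^sub>C x) = a *\<^sub>C T x)"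

definition spectrum :: "('a::complex_normed_vector \<Rightarrow> 'a) \<Rightarrow> complex set" where
  "spectrum T = {c. \<not> (\<exists>S. bounded_clinear S \<and>
     (\<forall>x. S (T x - c *\<^sub>C x) = x) \<and> (\<forall>x. T (S x) - c *\<^sub>C S x = x))}"

(* Meant for bounded linear T; boundedness and linearity are assumed separately. *)
definition norm_unimodal :: "('a::banach \<Rightarrow> 'a) \<Rightarrow> bool" where
  "norm_unimodal T \<longleftrightarrow> (\<exists>r>1. \<forall>m::nat. \<exists>x. x \<noteq> 0 \<and>
     (\<lambda>k. norm ((T ^^ k) x)) \<longlonglongrightarrow> 0 \<and>
     (\<forall>i\<in>{1..m}. norm ((T ^^ i) x) \<ge> r ^ i * norm x))"

end

theory Submission
  imports Defs "HOL-Complex_Analysis.Complex_Analysis" "HOL-Real_Asymp.Real_Asymp"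
begin

text \<open>
  If the circle of radius \<open>s\<close>, with \<open>1 < s < r\<close>, missed the spectrum, then compactness would give
  a constant \<open>M\<close> with \<open>norm v \<le> M * norm (T v - z v)\<close> for all \<open>v\<close> and all \<open>z\<close> on the circle.
  For a vector \<open>x\<close> with bounded orbit the series of the \<open>w\<^sup>k T\<^sup>k x\<close> converges for \<open>w = 1 / z\<close>
  to a vector \<open>h\<close> with \<open>(z - T) h = z x\<close>, hence of norm at most \<open>M s norm x\<close>. Cauchy's
  inequality for its coefficients gives \<open>norm (T\<^sup>m x) \<le> M s\<^sup>m\<^sup>+\<^sup>1 norm x\<close>, which is incompatible
  with growth like \<open>r\<^sup>m\<close> for large \<open>m\<close>. So every such circle meets the spectrum; now let \<open>s\<close>
  tend to \<open>1\<close> and pass to a convergent subsequence.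
\<close>

lemma cinner_add_right: "cinner (x::'a::complex_inner) (y + z) = cinner x y + cinner x z"
  by (metis cinner_add_left cinner_commute complex_cnj_add)

lemma cinner_scaleC_right: "cinner (x::'a::complex_inner) (a *\<^sub>C y) = cnj a * cinner x y"
  by (metis cinner_scaleC_left cinner_commute complex_cnj_mult)

lemma cinner_self: "cinner (x::'a::complex_inner) x = complex_of_real ((norm x)\<^sup>2)"
proof -
  have "Im (cinner x x) = 0"
    using cinner_commute[of x x] by (metis cnj.simps(2) equal_neg_zero)
  then show ?thesis
    using cinner_ge_zero[of x] by (simp add: complex_eq_iff norm_eq_sqrt_cinner)
qed

lemma scaleC_zero_left: "0 *\<^sub>C (x::'a::complex_vector) = 0"
  using scaleC_add_left[of 0 0 x] by simp

text \<open>Cauchy-Schwarz, read off from the nonnegativity of \<open>cinner ?v ?v\<close> for a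
  vector \<open>?v\<close> orthogonal to \<open>y\<close>.\<close>

lemma norm_cinner_le: "cmod (cinner x y) \<le> norm x * norm (y::'a::complex_inner)"
proof (cases "y = 0")
  case True
  then show ?thesis using cinner_scaleC_right[of x 0 y] by (simp add: scaleC_zero_left)
next
  case False
  define a where "a = cinner x y"
  define n where "n = complex_of_real ((norm y)\<^sup>2)"
  \<comment> \<open>\<open>?v\<close> is the component of \<open>x\<close> orthogonal to
    \<open>y\<close>, scaled by \<open>(norm y)\<^sup>2\<close> to avoid a division.\<close>
  let ?v = "n *\<^sub>C x + (- a) *\<^sub>C y"
  have yx: "cinner y x = cnj a" unfolding a_def by (rule cinner_commute)
  have "cinner ?v ?v = n * (n * of_real ((norm x)\<^sup>2) - a * cnj a)"
    by (simp add: cinner_add_left cinner_add_right cinner_scaleC_left cinner_scaleC_right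
        cinner_self[of x] cinner_self[of y] yx flip: a_def n_def)
      (simp add: n_def algebra_simps)
  also have "\<dots> = of_real ((norm y)\<^sup>2 * ((norm y)\<^sup>2 * (norm x)\<^sup>2 - (cmod a)\<^sup>2))"
    by (simp only: complex_norm_square[symmetric] n_def of_real_mult of_real_diff of_real_power)
  finally have "0 \<le> (norm y)\<^sup>2 * ((norm y)\<^sup>2 * (norm x)\<^sup>2 - (cmod a)\<^sup>2)"
    using cinner_ge_zero[of ?v] by simp
  then have "(cmod a)\<^sup>2 \<le> (norm x * norm y)\<^sup>2"
    using False by (simp add: zero_le_mult_iff power_mult_distrib mult.commute)
  then show ?thesis
    unfolding a_def by (rule power2_le_imp_le) simp
qed

lemma bounded_linear_cinner_left: "bounded_linear (\<lambda>x. cinner x (y::'a::complex_inner))"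
proof (rule bounded_linear_intro[where K = "norm y"])
  show "cinner (r *\<^sub>R x) y = r *\<^sub>R cinner x y" for r and x :: 'a
    by (simp add: scaleR_scaleC cinner_scaleC_left scaleR_conv_of_real)
qed (auto simp: cinner_add_left norm_cinner_le)

lemma bounded_linear_scaleC_right:
  "bounded_linear (\<lambda>x::'a::complex_normed_vector. a *\<^sub>C x)"
proof (rule bounded_linear_intro[where K = "cmod a"])
  show "a *\<^sub>C (r *\<^sub>R x) = r *\<^sub>R (a *\<^sub>C x)" for r and x :: 'a
    by (simp add: scaleR_scaleC scaleC_scaleC mult.commute)
qed (auto simp: scaleC_add_right norm_scaleC mult.commute)

text \<open>The bounded inverse \<open>S\<close> of \<open>T - c\<close> recovers \<open>v\<close>
  from \<open>T v - c v\<close>, so a bound for \<open>S\<close> serves as \<open>M\<close>.\<close>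

lemma bounded_below_if_not_in_spectrum:
  assumes "c \<notin> spectrum T"
  obtains M where "M > 0" "\<And>v. norm v \<le> M * norm (T v - c *\<^sub>C v)"
proof -
  from assms obtain S where S: "bounded_clinear S" "\<And>x. S (T x - c *\<^sub>C x) = x"
    unfolding spectrum_def by auto
  then obtain M where "M > 0" "\<And>x. norm (S x) \<le> norm x * M"
    unfolding bounded_clinear_def using bounded_linear.pos_bounded by blast
  then show thesis
    using that[of M] S(2) by (metis mult.commute)
qed

text \<open>The lower bound at a point \<open>c\<close> survives on a small disc around
  \<open>c\<close> with twice the constant; finitely many such discs cover \<open>K\<close>.\<close>

lemma uniformly_bounded_below:
  fixes T :: "'a::complex_normed_vector \<Rightarrow> 'a"
  assumes "compact K" "K \<inter> spectrum T = {}"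
  obtains M where "M \<ge> 0" "\<And>z v. z \<in> K \<Longrightarrow> norm v \<le> M * norm (T v - z *\<^sub>C v)"
proof -
  have "\<forall>c\<in>K. \<exists>M>0. \<forall>v. norm v \<le> M * norm (T v - c *\<^sub>C v)"
    using assms(2) bounded_below_if_not_in_spectrum by (metis disjoint_iff)
  then obtain M where M: "\<And>c. c \<in> K \<Longrightarrow> M c > 0"
    "\<And>c v. c \<in> K \<Longrightarrow> norm v \<le> M c * norm (T v - c *\<^sub>C v)"
    by metis
  \<comment> \<open>With this radius the perturbation \<open>(z - c) v\<close> contributes at most
    half of \<open>norm v\<close>, which the left-hand side absorbs.\<close>
  let ?B = "\<lambda>c. ball c (1 / (2 * M c))"
  obtain F where F: "F \<subseteq> K" "finite F" "K \<subseteq> (\<Union>c\<in>F. ?B c)"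
    using compactE_image[OF assms(1), of K ?B] M(1) by force
  show thesis
  \<comment> \<open>The sum stands in for the maximum and also makes sense for empty
    \<open>F\<close>.\<close>
  proof (rule that[of "\<Sum>c\<in>F. 2 * M c"])
    show "0 \<le> (\<Sum>c\<in>F. 2 * M c)"
      using F(1) M(1) by (intro sum_nonneg) (auto intro: less_imp_le)
  next
    fix z v assume "z \<in> K"
    then obtain c where c: "c \<in> F" "cmod (z - c) < 1 / (2 * M c)"
      using F(3) by (auto simp: dist_norm norm_minus_commute)
    then have cK: "c \<in> K" using F by auto
    have "T v - c *\<^sub>C v = (T v - z *\<^sub>C v) + (z - c) *\<^sub>C v"
      using scaleC_add_left[of "z - c" c v] by simp
    then have "norm (T v - c *\<^sub>C v) \<le> norm (T v - z *\<^sub>C v) + cmod (z - c) * norm v"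
      by (metis norm_scaleC norm_triangle_ineq)
    also have "\<dots> \<le> norm (T v - z *\<^sub>C v) + 1 / (2 * M c) * norm v"
      using c(2) by (intro add_left_mono mult_right_mono) auto
    finally have "norm v \<le> M c * (norm (T v - z *\<^sub>C v) + 1 / (2 * M c) * norm v)"
      using M[OF cK] by (meson mult_left_mono order.trans order.strict_implies_order)
    then have "norm v \<le> 2 * M c * norm (T v - z *\<^sub>C v)"
      using M(1)[OF cK] by (simp add: field_simps)
    also have "2 * M c \<le> (\<Sum>c\<in>F. 2 * M c)"
      using F c(1) M(1) by (intro member_le_sum) (auto intro: less_imp_le)
    finally show "norm v \<le> (\<Sum>c\<in>F. 2 * M c) * norm (T v - z *\<^sub>C v)"
      by (auto simp: mult_right_mono)
  qed
qed

text \<open>Bounded coefficients give radius of convergence at least 1, so the sum is holomorphic on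
  the closed disc of radius \<open>\<rho>\<close> and Cauchy's inequality applies there.\<close>

lemma norm_power_series_coeff_le:
  fixes a :: "nat \<Rightarrow> complex"
  assumes "Bseq a" "0 < \<rho>" "\<rho> < 1"
    and bound: "\<And>w. cmod w = \<rho> \<Longrightarrow> cmod (\<Sum>k. a k * w ^ k) \<le> B"
  shows "cmod (a m) \<le> B / \<rho> ^ m"
proof -
  define F where "F = Abs_fps a"
  obtain A where A: "A > 0" "\<And>k. cmod (a k) \<le> A"
    using assms(1) by (auto simp: Bseq_def)
  have summable: "summable (\<lambda>k. a k * w ^ k)" if "cmod w < 1" for w
  proof (rule summable_comparison_test')
    show "summable (\<lambda>k. A * cmod w ^ k)"
      using that by (intro summable_mult summable_geometric) auto
    show "norm (a k * w ^ k) \<le> A * cmod w ^ k" if "k \<ge> 0" for k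
      using A by (simp add: norm_mult norm_power mult_right_mono)
  qed
  have "conv_radius a \<ge> 1"
  proof (rule conv_radius_geI_ex')
    fix r :: real assume "0 < r" "ereal r < 1"
    then show "summable (\<lambda>n. a n * of_real r ^ n)"
      by (intro summable) (simp add: one_ereal_def)
  qed
  then have rad: "fps_conv_radius F \<ge> 1"
    by (simp add: fps_conv_radius_def F_def)
  have sub: "cball (0::complex) \<rho> \<subseteq> eball 0 (fps_conv_radius F)"
  proof
    fix w :: complex assume "w \<in> cball 0 \<rho>"
    then have "ereal (cmod w) < 1"
      using assms(3) by (simp add: one_ereal_def)
    also note rad
    finally show "w \<in> eball 0 (fps_conv_radius F)"
      by simp
  qed
  have hol: "eval_fps F holomorphic_on cball 0 \<rho>"
    using sub by (rule holomorphic_on_eval_fps)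
  have "cmod ((deriv ^^ m) (eval_fps F) 0) \<le> fact m * B / \<rho> ^ m"
  proof (rule Cauchy_inequality)
    show "eval_fps F holomorphic_on ball 0 \<rho>"
      using hol by (rule holomorphic_on_subset) auto
    show "continuous_on (cball 0 \<rho>) (eval_fps F)"
      using hol by (rule holomorphic_on_imp_continuous_on)
    show "cmod (eval_fps F w) \<le> B" if "cmod (0 - w) = \<rho>" for w
      using bound[of w] that by (simp add: eval_fps_def F_def)
  qed fact
  moreover have "a m = (deriv ^^ m) (eval_fps F) 0 / fact m"
    using fps_nth_conv_deriv[of F m] order.strict_trans2[OF _ rad, of 0] by (simp add: F_def)
  ultimately show ?thesis
    by (simp add: norm_divide divide_le_eq mult.commute)
qed

text \<open>Pairing the vector series with \<open>y\<close>, the iterate to be estimated, gives a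
  scalar power series whose coefficient of index \<open>m\<close> is the square of
  \<open>norm y\<close>. Cauchy's inequality bounds it by a multiple of \<open>norm y\<close>, and
  one factor cancels.\<close>

lemma norm_iterate_le:
  fixes T :: "'a::chilbert_space \<Rightarrow> 'a"
  assumes T: "bounded_clinear T" and "s > 1" and "M \<ge> 0"
    and M: "\<And>z v. cmod z = s \<Longrightarrow> norm v \<le> M * norm (T v - z *\<^sub>C v)"
    and Bx: "Bseq (\<lambda>k. (T ^^ k) x)"
  shows "norm ((T ^^ m) x) \<le> M * s ^ Suc m * norm x"
proof -
  define y where "y = (T ^^ m) x"
  define a where "a k = cinner ((T ^^ k) x) y" for k
  obtain A where A: "A > 0" "\<And>k. norm ((T ^^ k) x) \<le> A"
    using Bx by (auto simp: Bseq_def)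
  have linT: "bounded_linear T" and Tc: "T (c *\<^sub>C v) = c *\<^sub>C T v" for c v
    using T by (auto simp: bounded_clinear_def)
  have series: "cmod (\<Sum>k. a k * w ^ k) \<le> M * s * norm x * norm y" if w: "cmod w = 1 / s" for w
  proof -
    define h where "h = (\<Sum>k. w ^ k *\<^sub>C (T ^^ k) x)"
    define z where "z = inverse w"
    have [simp]: "w \<noteq> 0" using w \<open>s > 1\<close> by auto
    have z: "cmod z = s" using w by (simp add: z_def norm_inverse)
    \<comment> \<open>Convergence rests on the bounded orbit of \<open>x\<close> and
      \<open>cmod w < 1\<close>; the norm of \<open>T\<close> may well exceed
      \<open>s\<close>.\<close>
    have sm: "summable (\<lambda>k. w ^ k *\<^sub>C (T ^^ k) x)"
    proof (rule summable_comparison_test')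
      show "summable (\<lambda>k. cmod w ^ k * A)"
        using w \<open>s > 1\<close> by (intro summable_mult2 summable_geometric) auto
      show "norm (w ^ k *\<^sub>C (T ^^ k) x) \<le> cmod w ^ k * A" if "k \<ge> 0" for k
        using A by (simp add: norm_scaleC norm_power mult_left_mono)
    qed
    have "h = x + (\<Sum>k. w ^ Suc k *\<^sub>C (T ^^ Suc k) x)"
      using suminf_split_head[OF sm] by (simp add: h_def scaleC_one)
    also have "(\<Sum>k. w ^ Suc k *\<^sub>C (T ^^ Suc k) x) = (\<Sum>k. w *\<^sub>C T (w ^ k *\<^sub>C (T ^^ k) x))"
      by (simp add: Tc scaleC_scaleC)
    also have "\<dots> = w *\<^sub>C T h"
      unfolding h_def
      by (rule bounded_linear.suminf[OF bounded_linear_compose[OF bounded_linear_scaleC_right linT] sm, symmetric])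
    finally have "z *\<^sub>C h = z *\<^sub>C x + T h"
      by (metis \<open>w \<noteq> 0\<close> left_inverse scaleC_add_right scaleC_one scaleC_scaleC z_def)
    then have "T h - z *\<^sub>C h = - (z *\<^sub>C x)" by simp
    then have "norm h \<le> M * (s * norm x)"
      using M[OF z, of h] by (simp add: norm_scaleC z)
    moreover have "(\<Sum>k. a k * w ^ k) = cinner h y"
      using bounded_linear.suminf[OF bounded_linear_cinner_left[of y] sm]
      by (simp add: h_def a_def cinner_scaleC_left mult.commute)
    ultimately show ?thesis
      using norm_cinner_le[of h y] by (metis mult.assoc mult_right_mono norm_ge_zero order.trans)
  qed
  have "Bseq a"
  proof (rule BseqI')
    show "cmod (a k) \<le> A * norm y" for k
      unfolding a_def using norm_cinner_le A by (meson mult_right_mono norm_ge_zero order.trans)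
  qed
  then have "cmod (a m) \<le> M * s * norm x * norm y / (1 / s) ^ m"
    using \<open>s > 1\<close> series by (intro norm_power_series_coeff_le) auto
  moreover have "a m = complex_of_real ((norm y)\<^sup>2)"
    unfolding a_def by (simp only: cinner_self flip: y_def)
  ultimately have "norm y * norm y \<le> (M * s ^ Suc m * norm x) * norm y"
    by (simp add: power_divide power2_eq_square norm_mult mult_ac)
  moreover have "0 \<le> M * s ^ Suc m * norm x"
    using \<open>M \<ge> 0\<close> \<open>s > 1\<close> by simp
  \<comment> \<open>Cancelling \<open>norm y\<close> requires \<open>y\<close> to be nonzero;
    otherwise the bound holds because its right-hand side is nonnegative.\<close>
  ultimately show ?thesis
    unfolding y_def by (cases "(T ^^ m) x = 0") auto
qed

lemma spectrum_meets_circle: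
  fixes T :: "'a::chilbert_space \<Rightarrow> 'a"
  assumes T: "bounded_clinear T" and s: "1 < s" "s < r"
    and uni: "\<And>m. \<exists>x. x \<noteq> 0 \<and> (\<lambda>k. norm ((T ^^ k) x)) \<longlonglongrightarrow> 0 \<and>
      (\<forall>i\<in>{1..m}. norm ((T ^^ i) x) \<ge> r ^ i * norm x)"
  shows "\<exists>z\<in>spectrum T. cmod z = s"
proof (rule ccontr)
  assume "\<not> ?thesis"
  then have "sphere 0 s \<inter> spectrum T = {}" by auto
  then obtain M where "M \<ge> 0"
    and M: "\<And>z v. z \<in> sphere 0 s \<Longrightarrow> norm v \<le> M * norm (T v - z *\<^sub>C v)"
    using uniformly_bounded_below[OF compact_sphere] by blast
  \<comment> \<open>\<open>M\<close> depends only on \<open>T\<close> and \<open>s\<close>, so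
    \<open>m\<close> can be chosen after it, and the vector \<open>x\<close> after
    \<open>m\<close>.\<close>
  obtain m where m: "M * s < (r / s) ^ m"
    using s real_arch_pow[of "r / s" "M * s"] by auto
  obtain x where x: "x \<noteq> 0" "(\<lambda>k. norm ((T ^^ k) x)) \<longlonglongrightarrow> 0"
    "\<forall>i\<in>{1..m}. norm ((T ^^ i) x) \<ge> r ^ i * norm x"
    using uni by blast
  have "(\<lambda>k. (T ^^ k) x) \<longlonglongrightarrow> 0"
    using x(2) by (rule tendsto_norm_zero_cancel)
  then have "Bseq (\<lambda>k. (T ^^ k) x)"
    by (intro convergent_imp_Bseq convergentI)
  with T s(1) \<open>M \<ge> 0\<close> have "norm ((T ^^ m) x) \<le> M * s ^ Suc m * norm x"
    by (intro norm_iterate_le M) auto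
  \<comment> \<open>The growth condition starts at index 1, hence the separate case
    \<open>m = 0\<close>.\<close>
  moreover have "r ^ m * norm x \<le> norm ((T ^^ m) x)"
    using x(3) by (cases "m = 0") auto
  ultimately have "r ^ m \<le> M * s * s ^ m"
    using x(1) by (smt (verit) mult.assoc mult_right_le_imp_le power_Suc zero_less_norm_iff)
  with m s show False
    by (simp add: power_divide field_simps)
qed

theorem proposition2p2:
  fixes T :: "'a::chilbert_space \<Rightarrow> 'a"
  assumes "bounded_clinear T" and "norm_unimodal T"
  shows "\<exists>(\<mu>::nat \<Rightarrow> complex) l. (\<forall>n. \<mu> n \<in> spectrum T \<inter> {z. cmod z > 1}) \<and>
    \<mu> \<longlonglongrightarrow> l \<and> cmod l = 1"
proof -
  from assms(2) obtain r where r: "r > 1" "\<And>m. \<exists>x. x \<noteq> 0 \<and> (\<lambda>k. norm ((T ^^ k) x)) \<longlonglongrightarrow> 0 \<and>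
      (\<forall>i\<in>{1..m}. norm ((T ^^ i) x) \<ge> r ^ i * norm x)"
    unfolding norm_unimodal_def by blast
  \<comment> \<open>Radii tending to 1 from above; the shift by 2 keeps \<open>s 0\<close> strictly
    below \<open>r\<close>.\<close>
  define s where "s n = 1 + (r - 1) / real (n + 2)" for n
  have s: "1 < s n" "s n < r" for n
  proof -
    show "1 < s n" using r(1) by (simp add: s_def)
    have "(r - 1) * 1 < (r - 1) * real (n + 2)"
      using r(1) by (intro mult_strict_left_mono) auto
    then show "s n < r" by (simp add: s_def field_simps)
  qed
  have "\<forall>n. \<exists>z\<in>spectrum T. cmod z = s n"
    using spectrum_meets_circle[OF assms(1) s r(2)] by blast
  then obtain \<nu> where \<nu>: "\<And>n. \<nu> n \<in> spectrum T" "\<And>n. cmod (\<nu> n) = s n"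
    by metis
  have "\<nu> n \<in> cball 0 r" for n
    using \<nu>(2) s(2)[of n] by simp
  \<comment> \<open>The moduli converge already, but the arguments are uncontrolled, so a
    subsequence is needed.\<close>
  then obtain l f where lf: "strict_mono f" "(\<nu> \<circ> f) \<longlonglongrightarrow> l"
    using compact_cball[of 0 r] unfolding compact_def by meson
  have "s \<longlonglongrightarrow> 1"
    unfolding s_def by real_asymp
  then have "(\<lambda>n. cmod ((\<nu> \<circ> f) n)) \<longlonglongrightarrow> 1"
    using LIMSEQ_subseq_LIMSEQ[OF _ lf(1)] by (simp add: \<nu>(2) o_def)
  then have "cmod l = 1"
    using tendsto_norm[OF lf(2)] LIMSEQ_unique by blast
  then show ?thesis
    using lf(2) \<nu> s(1) by (intro exI[of _ "\<nu> \<circ> f"] exI[of _ l]) auto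
qed

end
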